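(* Let $p,N\in\mathbb{N}$ with $N>p$, let $S=\{w_1,\dots,w_N\}\subset\mathbb{R}^p$ be a set of size $N$, let $\lambda_1,\dots,\lambda_N>0$, and let $w^*=\sum_{j=1}^N\lambda_j w_j$. Run the algorithm "Exact Carathéodory" (described in the context) on the input $w_1,\dots,w_N$, $\lambda_1,\dots,\lambda_N$. Then, with probability $1$, the algorithm outputs $\alpha\in\mathbb{R}^p_+$ and $p$ vectors $\{w_{j_l}\}_{l=1}^p\subset S$ such that $$w^*=\sum_{l=1}^p\alpha_l w_{j_l}.$$
   Context: Algorithm "Exact Carathéodory". Input: $w_1,\dots,w_N\in\mathbb{R}^p$ and nonnegative coefficients $\lambda_1,\dots,\lambda_N$ such that $w^*=\sum_{j=1}^N\lambda_jw_j$. (1) Let $W\in\mathbb{R}^{p\times N}$ be the matrix whose columns are the vectors $w_j$. Draw a random vector $u\in\mathbb{R}^N$ with uniform distribution on the unit sphere and let $\tilde W_u=\begin{pmatrix} W \\ u^\top \end{pmatrix}\in\mathbb{R}^{(p+1)\times N}$. (2) Let $\tilde W^s_u$ be the submatrix made of the first $p+1$ columns of $\tilde W_u$, let $\alpha=(\lambda_1,\dots,\lambda_{p+1})$, and let $c=p+2$. (3) While $c\le N+1$: (a) solve $\tilde W^s_u\,\delta=\begin{pmatrix} \mathbf{0}_p \\ 1 \end{pmatrix}$ for $\delta\in\mathbb{R}^{p+1}$, where $\mathbf{0}_p$ is the zero vector of $\mathbb{R}^p$; (b) set $t^*=\min\{\alpha_j/\delta_j : \delta_j>0\}$, $\alpha'=\alpha-t^*\delta$,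 and $j^*=\arg\min_j\alpha'_j$; (c) remove the entry of index $j^*$ from $\alpha'$ and the column $j^*$ from $\tilde W^s_u$; (d) if $c=N+1$, set $\alpha=\alpha'$ and stop the loop; otherwise set $\alpha=(\alpha',\lambda_c)$, append column $c$ of $\tilde W_u$ as the last column of $\tilde W^s_u$, and increase $c$ by $1$. (4) Return $\alpha$ and the first $p$ rows of $\tilde W^s_u$ (the columns of this $p\times p$ matrix are the selected vectors $w_{j_l}$). The probability is with respect to the random vector $u$ drawn by the algorithm.
   Formalization: In step (b), t* is undefined when δ has no positive entry (possible with positive probability, e.g. p=1, N=2, w=(1,−1), λ=(1,1)); in that case the algorithm is taken to use t* = max{α_j/δ_j : δ_j<0}. *)

theory Defs
  imports "HOL-Analysis.Ball_Volume" "HOL-Probability.Probability_Measure"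
    "Jordan_Normal_Form.Matrix"
begin

unbundle no vec_syntax
hide_const (open) Finite_Cartesian_Product.vec Finite_Cartesian_Product.mat
  Finite_Cartesian_Product.row Finite_Cartesian_Product.column
hide_type (open) Finite_Cartesian_Product.vec

text \<open>Normalised surface measure of the unit sphere of \<open>\<real>\<^sup>N\<close>, as the radial projection of the
  uniform distribution on the unit ball (cone measure). The origin, which has no radial
  projection, is a null set for \<open>N \<ge> 1\<close>. Coordinates are numbered \<open>0, \<dots>, N - 1\<close>.\<close>

definition uniform_sphere :: "nat \<Rightarrow> (nat \<Rightarrow> real) measure" where
  "uniform_sphere N =
     distr (uniform_measure (PiM {..<N} (\<lambda>_. lborel))
              {x \<in> space (PiM {..<N} (\<lambda>_. lborel)). L2_set x {..<N} \<le> 1})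
           (PiM {..<N} (\<lambda>_. borel))
           (\<lambda>x. \<lambda>i\<in>{..<N}. x i / L2_set x {..<N})"

definition remove_nth :: "nat \<Rightarrow> 'a list \<Rightarrow> 'a list" where
  "remove_nth j xs = take j xs @ drop (Suc j) xs"

definition augmented_matrix :: "nat \<Rightarrow> nat \<Rightarrow> real vec list \<Rightarrow> (nat \<Rightarrow> real) \<Rightarrow> real mat" where
  "augmented_matrix p N w u = mat_of_cols p w @\<^sub>r mat_of_rows N [vec N u]"

text \<open>The step \<open>t\<^sup>*\<close>. The minimum defining it ranges over the empty set if \<open>\<delta>\<close> has no positive
  entry. Since \<open>\<delta>\<close> then has a negative one, the convention for this case is the step obtained
  from \<open>-\<delta>\<close>, i.e. \<open>-min {\<alpha>\<^sub>j / (-\<delta>\<^sub>j) | -\<delta>\<^sub>j > 0}\<close>, written as a maximum.\<close>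

definition step_length :: "real list \<Rightarrow> real vec \<Rightarrow> real" where
  "step_length \<alpha> \<delta> =
     (if \<exists>j<length \<alpha>. \<delta> $ j > 0
      then Min {\<alpha> ! j / \<delta> $ j | j. j < length \<alpha> \<and> \<delta> $ j > 0}
      else Max {\<alpha> ! j / \<delta> $ j | j. j < length \<alpha> \<and> \<delta> $ j < 0})"

text \<open>The system solved in each iteration need not have a unique solution and the minimal entry
  of \<open>\<alpha>'\<close> need not be unique, so the solver and the tie-breaking rule are parameters of the
  algorithm, constrained only as follows.\<close>

definition linear_solver :: "(real mat \<Rightarrow> real vec \<Rightarrow> real vec) \<Rightarrow> bool" where
  "linear_solver solve \<longleftrightarrow>
     (\<forall>A b. (\<exists>x \<in> carrier_vec (dim_col A). A *\<^sub>v x = b) \<longrightarrow>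
        solve A b \<in> carrier_vec (dim_col A) \<and> A *\<^sub>v solve A b = b)"

definition argmin_rule :: "(real list \<Rightarrow> nat) \<Rightarrow> bool" where
  "argmin_rule argmin \<longleftrightarrow>
     (\<forall>xs. xs \<noteq> [] \<longrightarrow> argmin xs < length xs \<and> (\<forall>i<length xs. xs ! argmin xs \<le> xs ! i))"

text \<open>The loop. The argument \<open>Wt\<close> is the full augmented matrix, \<open>cs\<close> is the list of columns of
  its current submatrix. Columns are numbered from \<open>0\<close>, so \<open>c\<close> is one less than in the
  one-based numbering: it starts at \<open>p + 1\<close>, and the iteration with \<open>c = N\<close> is the last one and
  appends nothing. The result \<open>None\<close> is failure of an iteration because its linear system has
  no solution.\<close>

function caratheodory_loop ::
  "(real mat \<Rightarrow> real vec \<Rightarrow> real vec) \<Rightarrow> (real list \<Rightarrow> nat) \<Rightarrow> nat \<Rightarrow> nat \<Rightarrow> real mat \<Rightarrow> real list \<Rightarrow>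
   nat \<Rightarrow> real list \<Rightarrow> real vec list \<Rightarrow> (real list \<times> real vec list) option" where
  "caratheodory_loop solve argmin p N Wt lam c \<alpha> cs =
     (if c \<le> N then
        let A = mat_of_cols (p + 1) cs;
            b = unit_vec (p + 1) p
        in if \<exists>x \<in> carrier_vec (dim_col A). A *\<^sub>v x = b then
             let \<delta> = solve A b;
                 t = step_length \<alpha> \<delta>;
                 \<alpha>' = map (\<lambda>j. \<alpha> ! j - t * \<delta> $ j) [0..<length \<alpha>];
                 j = argmin \<alpha>';
                 \<alpha>'' = remove_nth j \<alpha>';
                 cs' = remove_nth j cs
             in if c = N then Some (\<alpha>'', cs')
                else caratheodory_loop solve argmin p N Wt lam (c + 1)
                       (\<alpha>'' @ [lam ! c]) (cs' @ [col Wt c])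
           else None
      else Some (\<alpha>, cs))"
  by pat_completeness auto
termination
  by (relation "Wellfounded.measure (\<lambda>(solve, argmin, p, N, Wt, lam, c, \<alpha>, cs). N + 1 - c)") auto

declare caratheodory_loop.simps [simp del]

definition exact_caratheodory ::
  "(real mat \<Rightarrow> real vec \<Rightarrow> real vec) \<Rightarrow> (real list \<Rightarrow> nat) \<Rightarrow> nat \<Rightarrow> nat \<Rightarrow> real vec list \<Rightarrow>
   real list \<Rightarrow> (nat \<Rightarrow> real) \<Rightarrow> (real list \<times> real vec list) option" where
  "exact_caratheodory solve argmin p N w lam u =
     (let Wt = augmented_matrix p N w u
      in map_option (\<lambda>(\<alpha>, cs). (\<alpha>, map (\<lambda>v. vec_first v p) cs))
           (caratheodory_loop solve argmin p N Wt lam (p + 1)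
              (take (p + 1) lam) (take (p + 1) (cols Wt))))"

text \<open>\<open>uniform_sphere N\<close> is a probability measure concentrated on the sphere.\<close>

lemma uniform_sphere_ball:
  "emeasure (PiM {..<N} (\<lambda>_. lborel)) {x \<in> space (PiM {..<N} (\<lambda>_. lborel)). L2_set x {..<N} \<le> 1}
     = ennreal (unit_ball_vol (real N))"
  using emeasure_cball_aux[of "{..<N}" 1]
  by (simp add: L2_set_def Int_def conj_commute)

lemma uniform_sphere_projection_measurable:
  "(\<lambda>x. \<lambda>i\<in>{..<N}. x i / L2_set x {..<N}) \<in> PiM {..<N} (\<lambda>_. lborel) \<rightarrow>\<^sub>M PiM {..<N} (\<lambda>_. borel)"
  unfolding L2_set_def by measurable

lemma prob_space_uniform_sphere: "prob_space (uniform_sphere N)"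
proof -
  have "prob_space (uniform_measure (PiM {..<N} (\<lambda>_. lborel :: real measure))
     {x \<in> space (PiM {..<N} (\<lambda>_. lborel)). L2_set x {..<N} \<le> 1})"
    by (rule prob_space_uniform_measure)
      (simp_all only: uniform_sphere_ball, simp_all add: less_imp_neq[OF unit_ball_vol_pos, symmetric])
  then show ?thesis
    unfolding uniform_sphere_def
    by (rule prob_space.prob_space_distr)
      (use uniform_sphere_projection_measurable in
        \<open>simp only: measurable_cong_sets[OF sets_uniform_measure refl]\<close>)
qed

lemma AE_uniform_sphere_norm:
  assumes "N > 0"
  shows "AE u in uniform_sphere N. L2_set u {..<N} = 1"
proof -
  interpret product_sigma_finite "\<lambda>_ :: nat. lborel :: real measure" by standard
  let ?L = "PiM {..<N} (\<lambda>_. lborel :: real measure)"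
  let ?B = "{x \<in> space ?L. L2_set x {..<N} \<le> 1}"
  have null: "PiE {..<N} (\<lambda>_. {0}) \<in> null_sets ?L"
  proof (rule null_setsI)
    show "emeasure ?L (PiE {..<N} (\<lambda>_. {0})) = 0"
      using assms by (subst emeasure_PiM) (simp_all add: power_0_left)
    show "PiE {..<N} (\<lambda>_. {0}) \<in> sets ?L"
      by (rule sets_PiM_I_finite) simp_all
  qed
  have nz: "L2_set x {..<N} \<noteq> 0" if "x \<in> space ?L" "x \<notin> PiE {..<N} (\<lambda>_. {0})" for x
    using that by (auto simp: L2_set_eq_0_iff space_PiM PiE_iff extensional_def fun_eq_iff)
      (metis lessThan_iff)
  have "AE x in ?L. L2_set x {..<N} \<noteq> 0"
    using AE_not_in[OF null] AE_space by eventually_elim (use nz in blast)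
  moreover have "?B \<in> sets ?L"
    unfolding L2_set_def by measurable
  ultimately have ae: "AE x in uniform_measure ?L ?B. L2_set x {..<N} \<noteq> 0"
    by (intro AE_uniform_measureI) (auto elim: eventually_mono)
  have norm: "L2_set (\<lambda>i\<in>{..<N}. x i / L2_set x {..<N}) {..<N} = 1"
    if "L2_set x {..<N} \<noteq> 0" for x
  proof -
    have "L2_set (\<lambda>i\<in>{..<N}. x i / L2_set x {..<N}) {..<N}
        = L2_set (\<lambda>i. (1 / L2_set x {..<N}) * x i) {..<N}"
      by (rule L2_set_cong) auto
    also have "\<dots> = (1 / L2_set x {..<N}) * L2_set x {..<N}"
      by (rule L2_set_right_distrib[symmetric]) simp
    finally show ?thesis using that by simp
  qed
  show ?thesis
    unfolding uniform_sphere_def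
  proof (subst AE_distr_iff)
    show "(\<lambda>x. \<lambda>i\<in>{..<N}. x i / L2_set x {..<N}) \<in> uniform_measure ?L ?B \<rightarrow>\<^sub>M PiM {..<N} (\<lambda>_. borel)"
      using uniform_sphere_projection_measurable
      by (simp only: measurable_cong_sets[OF sets_uniform_measure refl])
    show "{x \<in> space (PiM {..<N} (\<lambda>_. borel)). L2_set x {..<N} = 1} \<in> sets (PiM {..<N} (\<lambda>_. borel))"
      unfolding L2_set_def by measurable
    show "AE x in uniform_measure ?L ?B. L2_set (\<lambda>i\<in>{..<N}. x i / L2_set x {..<N}) {..<N} = 1"
      using ae by eventually_elim (rule norm)
  qed
qed

end

theory Submission
  imports Defs "Jordan_Normal_Form.Determinant"
begin

text \<open>Any \<open>p + 1\<close> columns of \<open>W\<close> have a nonzero kernel vector, and almost surely \<open>u\<close> is orthogonal to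
  none of the finitely many vectors so chosen, one per selection of columns; rescaled, these
  vectors solve every system that the loop can meet. A solution \<open>\<delta>\<close> is a nonzero kernel vector of
  the first \<open>p\<close> rows, so \<open>\<alpha> - t\<^sup>* \<delta>\<close> represents the same partial sum, is nonnegative by
  the ratio test, and vanishes at some index. The minimal entry is therefore \<open>0\<close>, and removing it
  keeps the sum.\<close>

section \<open>Hyperplanes as null sets, first for Lebesgue measure and then on the sphere\<close>

text \<open>Fubini: integrate first over the coordinate \<open>j\<close>, whose coefficient is
  nonzero. Every fibre of the hyperplane in that direction lies in a one-point set, so it is
  null.\<close>

lemma AE_PiM_lborel_linear_form_neq_0:
  fixes k :: "'i \<Rightarrow> real"
  assumes "finite I" "j \<in> I" "k j \<noteq> 0"
  shows "AE x in PiM I (\<lambda>_. lborel). (\<Sum>i\<in>I. k i * x i) \<noteq> 0"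
proof -
  interpret product_sigma_finite "\<lambda>_ :: 'i. lborel :: real measure" by standard
  define J where "J = I - {j}"
  have J: "I = insert j J" "finite J" "j \<notin> J"
    using assms by (auto simp: J_def)
  let ?L = "PiM I (\<lambda>_. lborel :: real measure)"
  let ?H = "{x \<in> space ?L. (\<Sum>i\<in>I. k i * x i) = 0}"
  have H: "?H \<in> sets ?L" by measurable
  have fibre: "(\<integral>\<^sup>+ y. indicator ?H (x(j := y)) \<partial>lborel) = 0"
    if "x \<in> space (PiM J (\<lambda>_. lborel))" for x
  proof -
    have "(\<Sum>i\<in>I. k i * (x(j := y)) i) = k j * y + (\<Sum>i\<in>J. k i * x i)" for y
      using J by (simp, intro sum.cong) auto
    \<comment> \<open>Solve the equation of the hyperplane for \<open>y\<close>. The upper bound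
      suffices, so membership of \<open>x(j := y)\<close> in the space is not discussed.\<close>
    then have "indicator ?H (x(j := y)) \<le> (indicator {- (\<Sum>i\<in>J. k i * x i) / k j} y :: ennreal)" for y
      using assms(3) by (auto simp: indicator_def field_simps)
    then have "(\<integral>\<^sup>+ y. indicator ?H (x(j := y)) \<partial>lborel)
        \<le> (\<integral>\<^sup>+ y. indicator {- (\<Sum>i\<in>J. k i * x i) / k j} y \<partial>lborel)"
      by (intro nn_integral_mono) auto
    then show ?thesis by simp
  qed
  have "emeasure ?L ?H = (\<integral>\<^sup>+ x. indicator ?H x \<partial>?L)"
    using H by simp
  also have "\<dots> = (\<integral>\<^sup>+ x. \<integral>\<^sup>+ y. indicator ?H (x(j := y)) \<partial>lborel \<partial>PiM J (\<lambda>_. lborel))"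
    unfolding J(1) by (rule product_nn_integral_insert) (use J H in simp_all)
  also have "\<dots> = (\<integral>\<^sup>+ x. 0 \<partial>PiM J (\<lambda>_. lborel :: real measure))"
    by (rule nn_integral_cong) (rule fibre)
  finally have "?H \<in> null_sets ?L" using H by (intro null_setsI) simp_all
  from AE_not_in[OF this] AE_space show ?thesis
    by eventually_elim auto
qed

text \<open>Linear forms are homogeneous, so radial projection preserves nonvanishing; the null
  hyperplane in the ball thus yields a null set on the sphere.\<close>

lemma AE_uniform_sphere_linear_form_neq_0:
  assumes "j < N" "k j \<noteq> 0"
  shows "AE u in uniform_sphere N. (\<Sum>i<N. k i * u i) \<noteq> 0"
proof -
  let ?L = "PiM {..<N} (\<lambda>_. lborel :: real measure)"
  let ?B = "{x \<in> space ?L. L2_set x {..<N} \<le> 1}"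
  let ?\<pi> = "\<lambda>x. \<lambda>i\<in>{..<N}. x i / L2_set x {..<N}"
  have "?B \<in> sets ?L"
    unfolding L2_set_def by measurable
  with AE_PiM_lborel_linear_form_neq_0[of "{..<N}" j k] assms
  have "AE x in uniform_measure ?L ?B. (\<Sum>i<N. k i * x i) \<noteq> 0"
    by (intro AE_uniform_measureI) (auto elim: eventually_mono)
  moreover have "(\<Sum>i<N. k i * ?\<pi> x i) \<noteq> 0" if "(\<Sum>i<N. k i * x i) \<noteq> 0" for x
  proof -
    \<comment> \<open>A point at which the form is nonzero is not the origin, so the projection
      divides by a genuine norm there.\<close>
    have "L2_set x {..<N} \<noteq> 0"
      using that by (auto simp: L2_set_eq_0_iff dest: sum.not_neutral_contains_not_neutral)
    moreover have "(\<Sum>i<N. k i * ?\<pi> x i) = (\<Sum>i<N. k i * x i) / L2_set x {..<N}"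
      by (simp add: sum_divide_distrib)
    ultimately show ?thesis using that by simp
  qed
  ultimately have ae: "AE x in uniform_measure ?L ?B. (\<Sum>i<N. k i * ?\<pi> x i) \<noteq> 0"
    by (rule eventually_mono)
  show ?thesis
    unfolding uniform_sphere_def
  proof (subst AE_distr_iff)
    show "?\<pi> \<in> uniform_measure ?L ?B \<rightarrow>\<^sub>M PiM {..<N} (\<lambda>_. borel)"
      using uniform_sphere_projection_measurable
      by (simp only: measurable_cong_sets[OF sets_uniform_measure refl])
    show "{x \<in> space (PiM {..<N} (\<lambda>_. borel)). (\<Sum>i<N. k i * x i) \<noteq> 0} \<in> sets (PiM {..<N} (\<lambda>_. borel))"
      by measurable
  qed (rule ae)
qed

section \<open>Almost sure solvability of all linear systems of the loop\<close>

text \<open>Padding the \<open>p\<close> equations with a zero row gives a square matrix. Expansion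
  along that row shows that its determinant is 0, so its kernel is nontrivial.\<close>

lemma underdetermined_system_kernel:
  fixes X :: "nat \<Rightarrow> nat \<Rightarrow> real"
  obtains v where "v \<in> carrier_vec (p + 1)" "v \<noteq> 0\<^sub>v (p + 1)"
    "\<And>i. i < p \<Longrightarrow> (\<Sum>l<p + 1. X i l * v $ l) = 0"
proof -
  let ?A = "mat (p + 1) (p + 1) (\<lambda>(i, l). if i < p then X i l else 0)"
  have A: "?A \<in> carrier_mat (p + 1) (p + 1)" by simp
  have "det ?A = (\<Sum>j<p + 1. ?A $$ (p, j) * cofactor ?A p j)"
    by (rule laplace_expansion_row[OF A]) simp
  then have "det ?A = 0" by simp
  then obtain v where v: "v \<in> carrier_vec (p + 1)" "v \<noteq> 0\<^sub>v (p + 1)" "?A *\<^sub>v v = 0\<^sub>v (p + 1)"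
    using det_0_iff_vec_prod_zero_field[OF A] by blast
  have "(\<Sum>l<p + 1. X i l * v $ l) = 0" if "i < p" for i
  proof -
    have "(?A *\<^sub>v v) $ i = 0" using v(3) that by simp
    then show ?thesis
      using that v(1) by (simp add: scalar_prod_def atLeast0LessThan)
  qed
  with v(1,2) show thesis by (rule that)
qed

lemma
  assumes "length w = N"
  shows augmented_matrix_carrier: "augmented_matrix p N w u \<in> carrier_mat (p + 1) N"
    and augmented_matrix_index: "i < p \<Longrightarrow> j < N \<Longrightarrow> augmented_matrix p N w u $$ (i, j) = w ! j $ i"
    and augmented_matrix_last_row: "j < N \<Longrightarrow> augmented_matrix p N w u $$ (p, j) = u j"
  using assms
  by (auto simp: augmented_matrix_def append_rows_def mat_of_cols_index mat_of_rows_index)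

text \<open>All selections are covered at once, because those that the loop meets depend on
  \<open>u\<close>, on the solver and on the tie-breaking rule. Selections are index lists, so the
  condition refers to positions in \<open>W\<close> rather than to column values.\<close>

definition subsystems_solvable :: "nat \<Rightarrow> nat \<Rightarrow> real mat \<Rightarrow> bool" where
  "subsystems_solvable p N W \<longleftrightarrow>
     (\<forall>js. distinct js \<and> set js \<subseteq> {..<N} \<and> length js = p + 1 \<longrightarrow>
        (\<exists>x \<in> carrier_vec (p + 1). mat_of_cols (p + 1) (map (col W) js) *\<^sub>v x = unit_vec (p + 1) p))"

lemma mat_of_cols_col_mult_index:
  assumes "W \<in> carrier_mat n N" "set js \<subseteq> {..<N}" "i < n" "x \<in> carrier_vec (length js)"
  shows "(mat_of_cols n (map (col W) js) *\<^sub>v x) $ i = (\<Sum>l<length js. W $$ (i, js ! l) * x $ l)"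
proof -
  have "js ! l < N" if "l < length js" for l
    using that assms(2) nth_mem by blast
  then show ?thesis
    using assms by (auto simp: scalar_prod_def mat_of_cols_index atLeast0LessThan intro!: sum.cong)
qed

text \<open>A column selection is solvable as soon as \<open>u\<close> is not orthogonal to one fixed nonzero
  kernel vector of the selected columns, which excludes a single hyperplane.\<close>

lemma AE_subsystems_solvable:
  assumes "length w = N"
  shows "AE u in uniform_sphere N. subsystems_solvable p N (augmented_matrix p N w u)"
proof -
  let ?J = "{js. distinct js \<and> set js \<subseteq> {..<N} \<and> length js = p + 1}"
  let ?W = "augmented_matrix p N w"
  have "finite ?J"
    by (rule finite_subset[OF _ finite_lists_length_eq[of "{..<N}" "p + 1"]]) auto
  moreover have "AE u in uniform_sphere N. \<exists>x \<in> carrier_vec (p + 1).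
      mat_of_cols (p + 1) (map (col (?W u)) js) *\<^sub>v x = unit_vec (p + 1) p" if "js \<in> ?J" for js
  proof -
    have js: "distinct js" "set js \<subseteq> {..<N}" "length js = p + 1" using that by auto
    have js_less: "js ! l < N" if "l < p + 1" for l
      using that js nth_mem by (metis lessThan_iff subsetD)
    \<comment> \<open>\<open>v\<close> depends on \<open>w\<close> and \<open>js\<close> only and is
      fixed before \<open>u\<close> is drawn; hence the exceptional set is one fixed
      hyperplane.\<close>
    obtain v where v: "v \<in> carrier_vec (p + 1)" "v \<noteq> 0\<^sub>v (p + 1)"
      "\<And>i. i < p \<Longrightarrow> (\<Sum>l<p + 1. w ! (js ! l) $ i * v $ l) = 0"
      using underdetermined_system_kernel[of p "\<lambda>i l. w ! (js ! l) $ i"] by blast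
    from v(1,2) obtain l where l: "l < p + 1" "v $ l \<noteq> 0"
      by (metis carrier_vecD eq_vecI index_zero_vec(1) index_zero_vec(2))
    have inj: "inj_on ((!) js) {..<p + 1}"
      using js by (auto simp: inj_on_def nth_eq_iff_index_eq)
    \<comment> \<open>\<open>k\<close> places the entries of \<open>v\<close> at the positions
      \<open>js\<close> and is 0 elsewhere. As \<open>js\<close> is distinct, no two entries of
      \<open>v\<close> collide, and the nonzero entry survives.\<close>
    define k where "k j = (if j \<in> set js then v $ (inv_into {..<p + 1} ((!) js) j) else 0)" for j
    have k_nth: "k (js ! m) = v $ m" if "m < p + 1" for m
      using that js inv_into_f_f[OF inj, of m] by (simp add: k_def)
    have set_js: "set js = (!) js ` {..<p + 1}"
      using js(3) by (auto simp: set_conv_nth)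
    have form: "(\<Sum>i<N. k i * u i) = (\<Sum>m<p + 1. v $ m * u (js ! m))" for u :: "nat \<Rightarrow> real"
    proof -
      have "(\<Sum>i<N. k i * u i) = (\<Sum>i\<in>set js. k i * u i)"
        using js(2) by (intro sum.mono_neutral_right) (auto simp: k_def)
      also have "\<dots> = (\<Sum>m<p + 1. k (js ! m) * u (js ! m))"
        unfolding set_js by (subst sum.reindex[OF inj]) simp
      also have "\<dots> = (\<Sum>m<p + 1. v $ m * u (js ! m))"
        by (intro sum.cong) (auto simp: k_nth)
      finally show ?thesis .
    qed
    have "AE u in uniform_sphere N. (\<Sum>i<N. k i * u i) \<noteq> 0"
      by (rule AE_uniform_sphere_linear_form_neq_0[of "js ! l"]) (use l js_less k_nth in auto)
    then show ?thesis
    proof eventually_elim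
      case (elim u)
      \<comment> \<open>\<open>?q\<close> is the value of the last row of the subsystem at
        \<open>v\<close>. Dividing \<open>v\<close> by it makes that value 1, and the other rows
        still give 0.\<close>
      let ?q = "\<Sum>i<N. k i * u i"
      let ?x = "(1 / ?q) \<cdot>\<^sub>v v"
      have "mat_of_cols (p + 1) (map (col (?W u)) js) *\<^sub>v ?x = unit_vec (p + 1) p"
      proof (rule eq_vecI)
        fix i assume "i < dim_vec (unit_vec (p + 1) p :: real vec)"
        then have i: "i < p + 1" by simp
        have "(mat_of_cols (p + 1) (map (col (?W u)) js) *\<^sub>v ?x) $ i
            = (\<Sum>m<p + 1. ?W u $$ (i, js ! m) * ?x $ m)"
          using mat_of_cols_col_mult_index[OF augmented_matrix_carrier[OF assms] js(2) i] v(1)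
          by (simp add: js(3))
        also have "\<dots> = (1 / ?q) * (\<Sum>m<p + 1. ?W u $$ (i, js ! m) * v $ m)"
          unfolding sum_distrib_left using v(1) by (intro sum.cong) auto
        also have "(\<Sum>m<p + 1. ?W u $$ (i, js ! m) * v $ m) = (if i = p then ?q else 0)"
        proof (cases "i = p")
          case True
          have "(\<Sum>m<p + 1. ?W u $$ (i, js ! m) * v $ m) = (\<Sum>m<p + 1. v $ m * u (js ! m))"
            by (intro sum.cong) (use True js_less in \<open>auto simp: augmented_matrix_last_row[OF assms]\<close>)
          with True form show ?thesis by simp
        next
          case False
          then have "i < p" using i by simp
          then have "(\<Sum>m<p + 1. ?W u $$ (i, js ! m) * v $ m) = (\<Sum>m<p + 1. w ! (js ! m) $ i * v $ m)"
            by (intro sum.cong) (use js_less in \<open>auto simp: augmented_matrix_index[OF assms]\<close>)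
          with False v(3)[OF \<open>i < p\<close>] show ?thesis by simp
        qed
        finally show "(mat_of_cols (p + 1) (map (col (?W u)) js) *\<^sub>v ?x) $ i = unit_vec (p + 1) p $ i"
          using i elim by simp
      qed simp
      then show ?case using v(1) by (intro bexI[of _ ?x]) auto
    qed
  qed
  ultimately have "AE u in uniform_sphere N. \<forall>js\<in>?J. \<exists>x \<in> carrier_vec (p + 1).
      mat_of_cols (p + 1) (map (col (?W u)) js) *\<^sub>v x = unit_vec (p + 1) p"
    by (rule AE_finite_allI)
  then show ?thesis
    unfolding subsystems_solvable_def by eventually_elim blast
qed

section \<open>The ratio test\<close>

text \<open>If some entry of \<delta> is positive, the step is nonnegative, so entries with \<delta>
  nonpositive do not decrease, and it is at most each ratio with positive denominator. Otherwise the
  step is at least each ratio with negative denominator, and multiplying by that denominator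
  reverses the inequality.\<close>

lemma step_length_nonneg:
  assumes "\<And>i. i < length \<alpha> \<Longrightarrow> \<alpha> ! i \<ge> 0" "i < length \<alpha>"
  shows "\<alpha> ! i - step_length \<alpha> \<delta> * \<delta> $ i \<ge> 0"
proof (cases "\<exists>j<length \<alpha>. \<delta> $ j > 0")
  case True
  let ?T = "{\<alpha> ! j / \<delta> $ j | j. j < length \<alpha> \<and> \<delta> $ j > 0}"
  have t: "step_length \<alpha> \<delta> = Min ?T" using True by (simp add: step_length_def)
  have "Min ?T \<in> ?T" by (rule Min_in) (use True in auto)
  then have "step_length \<alpha> \<delta> \<ge> 0" using t assms(1) by auto
  moreover have "step_length \<alpha> \<delta> \<le> \<alpha> ! i / \<delta> $ i" if "\<delta> $ i > 0"
    unfolding t by (rule Min_le) (use that assms(2) in auto)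
  ultimately show ?thesis
    using assms by (cases "\<delta> $ i > 0")
      (auto simp: field_simps intro: order_trans[OF mult_nonneg_nonpos])
next
  case False
  let ?T = "{\<alpha> ! j / \<delta> $ j | j. j < length \<alpha> \<and> \<delta> $ j < 0}"
  have t: "step_length \<alpha> \<delta> = Max ?T" using False by (auto simp: step_length_def)
  have "step_length \<alpha> \<delta> \<ge> \<alpha> ! i / \<delta> $ i" if "\<delta> $ i < 0"
    unfolding t by (rule Max_ge) (use that assms(2) in auto)
  \<comment> \<open>No entry is positive in this case. At a zero entry the step has no effect,
    whatever its value.\<close>
  moreover have "\<delta> $ i = 0" if "\<not> \<delta> $ i < 0"
    using False assms(2) that by force
  ultimately show ?thesis
    using assms by (cases "\<delta> $ i < 0") (auto simp: field_simps)
qed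

text \<open>The minimum or maximum is attained at some ratio, and the index of that ratio is the one
  eliminated. The nonzero entry at \<open>k\<close> ensures that the set of ratios is nonempty in
  either case.\<close>

lemma step_length_eliminates:
  assumes "k < length \<alpha>" "\<delta> $ k \<noteq> 0"
  obtains j where "j < length \<alpha>" "\<alpha> ! j - step_length \<alpha> \<delta> * \<delta> $ j = 0"
proof (cases "\<exists>j<length \<alpha>. \<delta> $ j > 0")
  case True
  let ?T = "{\<alpha> ! j / \<delta> $ j | j. j < length \<alpha> \<and> \<delta> $ j > 0}"
  have "Min ?T \<in> ?T" by (rule Min_in) (use True in auto)
  moreover have "step_length \<alpha> \<delta> = Min ?T" using True by (simp add: step_length_def)
  ultimately show thesis using that by fastforce
next
  case False
  let ?T = "{\<alpha> ! j / \<delta> $ j | j. j < length \<alpha> \<and> \<delta> $ j < 0}"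
  have "\<delta> $ k < 0" using False assms by force
  then have "Max ?T \<in> ?T" by (intro Max_in) (use assms in auto)
  moreover have "step_length \<alpha> \<delta> = Max ?T" using False by (auto simp: step_length_def)
  ultimately show thesis using that by fastforce
qed

section \<open>Removing one index from a list or from two parallel lists\<close>

lemma length_remove_nth: "j < length xs \<Longrightarrow> length (remove_nth j xs) = length xs - 1"
  by (simp add: remove_nth_def)

lemma map_remove_nth: "map f (remove_nth j xs) = remove_nth j (map f xs)"
  by (simp add: remove_nth_def take_map drop_map)

lemma nth_remove_nth:
  "j < length xs \<Longrightarrow> l < length xs - 1 \<Longrightarrow> remove_nth j xs ! l = xs ! (if l < j then l else Suc l)"
  by (auto simp: remove_nth_def nth_append min_def)

lemma set_remove_nth_subset: "set (remove_nth j xs) \<subseteq> set xs"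
  by (auto simp: remove_nth_def dest: in_set_takeD in_set_dropD)

lemma distinct_remove_nth: "distinct xs \<Longrightarrow> distinct (remove_nth j xs)"
  by (auto simp: remove_nth_def set_take_disj_set_drop_if_distinct)

text \<open>Applied to the coefficients and the column indices together: the removed coefficient is
  0 there, so the weighted sum does not change.\<close>

lemma sum_remove_nth:
  fixes f :: "'a \<Rightarrow> 'b \<Rightarrow> 'c::ab_group_add"
  assumes "j < length xs" "length ys = length xs"
  shows "(\<Sum>l<length xs - 1. f (remove_nth j xs ! l) (remove_nth j ys ! l))
    = (\<Sum>l<length xs. f (xs ! l) (ys ! l)) - f (xs ! j) (ys ! j)"
proof -
  \<comment> \<open>The increasing enumeration of the indices that skips \<open>j\<close>.\<close>
  let ?s = "\<lambda>l. if l < j then l else Suc l"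
  have "inj_on ?s {..<length xs - 1}" by (auto simp: inj_on_def split: if_splits)
  moreover have "?s ` {..<length xs - 1} = {..<length xs} - {j}"
  proof (intro equalityI subsetI)
    fix m assume m: "m \<in> {..<length xs} - {j}"
    show "m \<in> ?s ` {..<length xs - 1}"
    proof (cases "m < j")
      case True
      then show ?thesis using assms by (intro image_eqI[of _ _ m]) auto
    next
      case False
      then show ?thesis using m by (intro image_eqI[of _ _ "m - 1"]) auto
    qed
  qed (use assms in auto)
  ultimately have "(\<Sum>l\<in>{..<length xs} - {j}. f (xs ! l) (ys ! l))
      = (\<Sum>l<length xs - 1. f (xs ! ?s l) (ys ! ?s l))"
    by (metis (no_types, lifting) sum.reindex_cong)
  also have "\<dots> = (\<Sum>l<length xs - 1. f (remove_nth j xs ! l) (remove_nth j ys ! l))"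
    using assms by (intro sum.cong) (simp_all add: nth_remove_nth)
  finally show ?thesis
    using assms by (simp add: sum.remove[of "{..<length xs}" j])
qed

section \<open>The loop invariant\<close>

text \<open>The invariant: the current combination plus the untouched tail from \<open>c\<close> on
  equals the target \<open>s\<close> in the first \<open>p\<close> rows. Columns are tracked by
  their indices \<open>js\<close>, all below \<open>c\<close>, so the index \<open>c\<close>
  appended next is always new and the selection stays distinct.\<close>

lemma caratheodory_loop_correct:
  assumes "linear_solver solve" "argmin_rule argmin" "W \<in> carrier_mat (p + 1) N"
    "subsystems_solvable p N W" "c \<le> N"
    "length \<alpha> = p + 1" "\<And>l. l < p + 1 \<Longrightarrow> \<alpha> ! l \<ge> 0" "\<And>j. j < N \<Longrightarrow> lam ! j \<ge> 0"
    "length js = p + 1" "distinct js" "set js \<subseteq> {..<c}"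
    "\<And>i. i < p \<Longrightarrow> (\<Sum>l<p + 1. \<alpha> ! l * W $$ (i, js ! l)) + (\<Sum>j=c..<N. lam ! j * W $$ (i, j)) = s i"
  shows "\<exists>\<beta> ks. caratheodory_loop solve argmin p N W lam c \<alpha> (map (col W) js) = Some (\<beta>, map (col W) ks) \<and>
    length \<beta> = p \<and> (\<forall>l<p. \<beta> ! l \<ge> 0) \<and> length ks = p \<and> distinct ks \<and> set ks \<subseteq> {..<N} \<and>
    (\<forall>i<p. (\<Sum>l<p. \<beta> ! l * W $$ (i, ks ! l)) = s i)"
  using assms(5-)
proof (induction "N - c" arbitrary: c \<alpha> js rule: less_induct)
  case less
  note c = less.prems(1) and \<alpha> = less.prems(2,3) and lam = less.prems(4)
    and js = less.prems(5,6) and js_c = less.prems(7) and combination = less.prems(8)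
  have js_N: "set js \<subseteq> {..<N}" using js_c c by auto
  let ?A = "mat_of_cols (p + 1) (map (col W) js)"
  let ?b = "unit_vec (p + 1) p"
  have dim: "dim_col ?A = p + 1" using js by simp
  have solvable: "\<exists>x \<in> carrier_vec (dim_col ?A). ?A *\<^sub>v x = ?b"
    using assms(4) js js_N unfolding subsystems_solvable_def dim by blast
  define \<delta> where "\<delta> = solve ?A ?b"
  have \<delta>: "\<delta> \<in> carrier_vec (p + 1)" "?A *\<^sub>v \<delta> = ?b"
    using assms(1)[unfolded linear_solver_def, rule_format, OF solvable] dim
    by (simp_all add: \<delta>_def)
  have rows: "(\<Sum>l<p + 1. W $$ (i, js ! l) * \<delta> $ l) = ?b $ i" if "i < p + 1" for i
    using mat_of_cols_col_mult_index[OF assms(3) js_N that, of \<delta>] \<delta> js(1) by simp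
  \<comment> \<open>The last equation has right-hand side 1, which forces \<delta> to be
    nonzero.\<close>
  obtain k where k: "k < p + 1" "\<delta> $ k \<noteq> 0"
  proof -
    have "(\<Sum>l<p + 1. W $$ (p, js ! l) * \<delta> $ l) \<noteq> 0" using rows[of p] by simp
    then obtain l where "l \<in> {..<p + 1}" "W $$ (p, js ! l) * \<delta> $ l \<noteq> 0"
      by (rule sum.not_neutral_contains_not_neutral)
    then show thesis using that by auto
  qed
  define t where "t = step_length \<alpha> \<delta>"
  define \<alpha>' where "\<alpha>' = map (\<lambda>l. \<alpha> ! l - t * \<delta> $ l) [0..<length \<alpha>]"
  define j where "j = argmin \<alpha>'"
  define \<alpha>'' where "\<alpha>'' = remove_nth j \<alpha>'"
  define ks where "ks = remove_nth j js"
  have \<alpha>'_length: "length \<alpha>' = p + 1" using \<alpha> by (simp add: \<alpha>'_def)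
  have \<alpha>'_nth: "\<alpha>' ! l = \<alpha> ! l - t * \<delta> $ l" if "l < p + 1" for l
    using that \<alpha>(1) by (simp add: \<alpha>'_def del: upt_Suc)
  have \<alpha>'_nonneg: "\<alpha>' ! l \<ge> 0" if "l < p + 1" for l
    using step_length_nonneg[of \<alpha> l \<delta>] that \<alpha> by (simp add: \<alpha>'_nth t_def)
  have "\<alpha>' \<noteq> []" using \<alpha>'_length by auto
  then have j: "j < p + 1" "\<And>l. l < p + 1 \<Longrightarrow> \<alpha>' ! j \<le> \<alpha>' ! l"
    using assms(2) \<alpha>'_length by (auto simp: argmin_rule_def j_def)
  obtain m where "m < length \<alpha>" "\<alpha> ! m - t * \<delta> $ m = 0"
    using step_length_eliminates[of k \<alpha> \<delta>] k \<alpha>(1) unfolding t_def by metis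
  \<comment> \<open>Some entry of \<open>\<alpha>'\<close> is 0, so the minimal one is at most 0,
    and by nonnegativity it equals 0 for any tie-breaking rule.\<close>
  then have "\<alpha>' ! j \<le> 0" using j(2)[of m] \<alpha>(1) \<alpha>'_nth by simp
  then have \<alpha>'_j: "\<alpha>' ! j = 0" using \<alpha>'_nonneg[OF j(1)] by simp
  have \<alpha>''_length: "length \<alpha>'' = p"
    using j(1) \<alpha>'_length by (simp add: \<alpha>''_def length_remove_nth)
  have \<alpha>''_nonneg: "\<alpha>'' ! l \<ge> 0" if "l < p" for l
    using that j(1) \<alpha>'_nonneg by (simp add: \<alpha>''_def nth_remove_nth \<alpha>'_length)
  have ks: "length ks = p" "distinct ks" "set ks \<subseteq> {..<c}"
    using j(1) js js_c set_remove_nth_subset[of j js]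
    by (auto simp: ks_def length_remove_nth distinct_remove_nth)
  \<comment> \<open>In the first \<open>p\<close> rows the right-hand side is 0, so moving along
    \<delta> leaves the sum unchanged; dropping a zero coefficient does too.\<close>
  have reduced: "(\<Sum>l<p. \<alpha>'' ! l * W $$ (i, ks ! l)) = (\<Sum>l<p + 1. \<alpha> ! l * W $$ (i, js ! l))"
    if "i < p" for i
  proof -
    have "(\<Sum>l<p. \<alpha>'' ! l * W $$ (i, ks ! l)) = (\<Sum>l<p + 1. \<alpha>' ! l * W $$ (i, js ! l))"
      using sum_remove_nth[of j \<alpha>' js "\<lambda>a k. a * W $$ (i, k)"] j(1) js(1) \<alpha>'_j
      by (simp add: \<alpha>'_length \<alpha>''_def ks_def)
    also have "\<dots> = (\<Sum>l<p + 1. \<alpha> ! l * W $$ (i, js ! l) - t * (W $$ (i, js ! l) * \<delta> $ l))"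
      by (intro sum.cong) (auto simp: \<alpha>'_nth algebra_simps)
    also have "\<dots> = (\<Sum>l<p + 1. \<alpha> ! l * W $$ (i, js ! l)) - t * ?b $ i"
      using rows[of i] that by (simp only: sum_subtractf sum_distrib_left[symmetric])
    finally show ?thesis using that by simp
  qed
  \<comment> \<open>One unfolding, with the solvability test passed and the appended column written
    as index \<open>c\<close>, which is the form that the induction hypothesis takes.\<close>
  have loop: "caratheodory_loop solve argmin p N W lam c \<alpha> (map (col W) js) =
    (if c = N then Some (\<alpha>'', map (col W) ks)
     else caratheodory_loop solve argmin p N W lam (c + 1) (\<alpha>'' @ [lam ! c]) (map (col W) (ks @ [c])))"
    using c solvable
    by (subst caratheodory_loop.simps)
      (simp add: Let_def \<alpha>''_def ks_def map_remove_nth j_def \<alpha>'_def t_def \<delta>_def)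
  show ?case
  proof (cases "c = N")
    \<comment> \<open>The tail from \<open>N\<close> on is empty, so the reduced combination alone
      is the target.\<close>
    case True
    then show ?thesis
      using loop \<alpha>''_length \<alpha>''_nonneg ks reduced combination
      by (intro exI[of _ \<alpha>''] exI[of _ ks]) auto
  next
    case False
    then have c_less: "c < N" using c by simp
    show ?thesis
      unfolding loop if_not_P[OF False]
    \<comment> \<open>The first summand of the tail moves into the combination as its last
      term.\<close>
    proof (rule less.hyps)
      show "(\<alpha>'' @ [lam ! c]) ! l \<ge> 0" if "l < p + 1" for l
        using that \<alpha>''_nonneg \<alpha>''_length lam[OF c_less] by (auto simp: nth_append less_Suc_eq)
      show "(\<Sum>l<p + 1. (\<alpha>'' @ [lam ! c]) ! l * W $$ (i, (ks @ [c]) ! l)) +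
          (\<Sum>j=c + 1..<N. lam ! j * W $$ (i, j)) = s i" if "i < p" for i
        using combination[OF that] reduced[OF that] c_less \<alpha>''_length ks(1)
        by (simp add: nth_append sum.atLeast_Suc_lessThan)
    qed (use c_less \<alpha>''_length ks lam in auto)
  qed
qed

section \<open>Almost sure correctness of the algorithm\<close>

theorem theorem2p3:
  fixes p N :: nat and S :: "real vec set" and w :: "real vec list" and lam :: "real list"
    and wstar :: "real vec"
    and solve :: "real mat \<Rightarrow> real vec \<Rightarrow> real vec" and argmin :: "real list \<Rightarrow> nat"
  assumes "N > p"
    and "S \<subseteq> carrier_vec p" and "card S = N"
    and "length w = N" and "set w = S"
    and "length lam = N" and "\<forall>j<N. lam ! j > 0"
    and "wstar = finsum_vec TYPE(real) p (\<lambda>j. lam ! j \<cdot>\<^sub>v w ! j) {..<N}"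
    and "linear_solver solve" and "argmin_rule argmin"
  shows "AE u in uniform_sphere N. \<exists>\<alpha> v.
           exact_caratheodory solve argmin p N w lam u = Some (\<alpha>, v) \<and>
           length \<alpha> = p \<and> (\<forall>l<p. \<alpha> ! l \<ge> 0) \<and>
           length v = p \<and> distinct v \<and> set v \<subseteq> S \<and>
           wstar = finsum_vec TYPE(real) p (\<lambda>l. \<alpha> ! l \<cdot>\<^sub>v v ! l) {..<p}"
  using AE_subsystems_solvable[OF \<open>length w = N\<close>, of p]
proof eventually_elim
  case (elim u)
  let ?W = "augmented_matrix p N w u"
  note W = augmented_matrix_carrier[OF assms(4), of p u]
  \<comment> \<open>The list \<open>w\<close> has as many entries as its set has elements, so
    distinct indices select distinct vectors.\<close>
  have w: "distinct w" "\<And>j. j < N \<Longrightarrow> w ! j \<in> carrier_vec p"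
    using assms(2-5) by (auto intro: card_distinct)
  have dim_w: "dim_vec (w ! j) = p" if "j < N" for j
    using w(2)[OF that] by simp
  have start: "take (p + 1) (cols ?W) = map (col ?W) [0..<p + 1]"
    using W assms(1) by (simp add: cols_def take_map take_upt)
  \<comment> \<open>The invariant holds initially: \<open>wstar\<close> is split into its first
    \<open>p + 1\<close> terms and the tail. These terms exist because \<open>N > p\<close>.\<close>
  have "(\<Sum>l<p + 1. take (p + 1) lam ! l * ?W $$ (i, [0..<p + 1] ! l)) + (\<Sum>j=p + 1..<N. lam ! j * ?W $$ (i, j))
      = wstar $ i" if "i < p" for i
  proof -
    have "wstar $ i = (\<Sum>j<N. (lam ! j \<cdot>\<^sub>v w ! j) $ i)"
      unfolding assms(8) by (rule index_finsum_vec) (use that w in auto)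
    also have "\<dots> = (\<Sum>j<N. lam ! j * ?W $$ (i, j))"
      using that
      by (intro sum.cong) (auto simp: augmented_matrix_index[OF assms(4)] dim_w)
    also have "\<dots> = (\<Sum>j<p + 1. lam ! j * ?W $$ (i, j)) + (\<Sum>j=p + 1..<N. lam ! j * ?W $$ (i, j))"
      using assms(1) sum.atLeastLessThan_concat[of 0 "p + 1" N "\<lambda>j. lam ! j * ?W $$ (i, j)"]
      by (simp only: atLeast0LessThan)
    also have "(\<Sum>j<p + 1. lam ! j * ?W $$ (i, j))
        = (\<Sum>l<p + 1. take (p + 1) lam ! l * ?W $$ (i, [0..<p + 1] ! l))"
      by (intro sum.cong) (auto simp del: upt_Suc)
    finally show ?thesis by simp
  qed
  then have "\<exists>\<alpha> ks. caratheodory_loop solve argmin p N ?W lam (p + 1) (take (p + 1) lam)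
        (map (col ?W) [0..<p + 1]) = Some (\<alpha>, map (col ?W) ks) \<and>
      length \<alpha> = p \<and> (\<forall>l<p. \<alpha> ! l \<ge> 0) \<and> length ks = p \<and> distinct ks \<and> set ks \<subseteq> {..<N} \<and>
      (\<forall>i<p. (\<Sum>l<p. \<alpha> ! l * ?W $$ (i, ks ! l)) = wstar $ i)"
    using assms(1,6,7)
    by (intro caratheodory_loop_correct[OF assms(9,10) W elim]) (auto simp: less_imp_le simp del: upt_Suc)
  then obtain \<alpha> ks where loop: "caratheodory_loop solve argmin p N ?W lam (p + 1) (take (p + 1) lam)
        (map (col ?W) [0..<p + 1]) = Some (\<alpha>, map (col ?W) ks)"
    and \<alpha>: "length \<alpha> = p" "\<forall>l<p. \<alpha> ! l \<ge> 0"
    and ks: "length ks = p" "distinct ks" "set ks \<subseteq> {..<N}"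
    and combination: "\<And>i. i < p \<Longrightarrow> (\<Sum>l<p. \<alpha> ! l * ?W $$ (i, ks ! l)) = wstar $ i"
    by blast
  have ks_N: "ks ! l < N" if "l < p" for l
    using that ks nth_mem by (metis lessThan_iff subsetD)
  define v where "v = map ((!) w) ks"
  \<comment> \<open>Truncating a column discards its entry of \<open>u\<close> and recovers the
    input vector.\<close>
  have "vec_first (col ?W k) p = w ! k" if "k < N" for k
    using that W w(2)[OF that]
    by (intro eq_vecI) (auto simp: vec_first_def augmented_matrix_index[OF assms(4)])
  then have "map (\<lambda>x. vec_first x p) (map (col ?W) ks) = v"
    using ks(3) by (auto simp: v_def)
  then have "exact_caratheodory solve argmin p N w lam u = Some (\<alpha>, v)"
    unfolding exact_caratheodory_def Let_def start loop by simp
  moreover have "distinct v"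
    unfolding v_def distinct_map using ks w(1) assms(4)
    by (auto simp: inj_on_def nth_eq_iff_index_eq subset_iff)
  moreover have "set v \<subseteq> S"
    using ks(3) assms(4,5) by (auto simp: v_def)
  moreover have "wstar = finsum_vec TYPE(real) p (\<lambda>l. \<alpha> ! l \<cdot>\<^sub>v v ! l) {..<p}" (is "_ = ?s")
  proof (rule eq_vecI)
    have v: "(\<lambda>l. \<alpha> ! l \<cdot>\<^sub>v v ! l) \<in> {..<p} \<rightarrow> carrier_vec p"
      using ks ks_N w(2) by (auto simp: v_def)
    then have s: "?s \<in> carrier_vec p" by (rule finsum_vec_closed)
    have "wstar \<in> carrier_vec p"
      unfolding assms(8) by (rule finsum_vec_closed) (use w(2) in auto)
    with s show "dim_vec wstar = dim_vec ?s" by simp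
    fix i assume "i < dim_vec ?s"
    then have i: "i < p" using s by simp
    have "?s $ i = (\<Sum>l<p. (\<alpha> ! l \<cdot>\<^sub>v v ! l) $ i)"
      by (rule index_finsum_vec) (use i v in auto)
    also have "\<dots> = (\<Sum>l<p. \<alpha> ! l * ?W $$ (i, ks ! l))"
      using i ks ks_N
      by (intro sum.cong) (auto simp: v_def augmented_matrix_index[OF assms(4)] dim_w)
    finally show "wstar $ i = ?s $ i" using combination[OF i] by simp
  qed
  ultimately show ?case
    using \<alpha> ks by (intro exI[of _ \<alpha>] exI[of _ v]) (auto simp: v_def)
qed

end
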